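(* Let $x\in[-1,1]$ and define the sequence $(f_k)_{k\ge 0}$ by \[ f_0=1,\qquad f_{k+1}=\tfrac12\, f_k\bigl(3-x^2 f_k^2\bigr)\quad (k\ge 0). \] (i) If $x\neq 0$, then $(f_k)$ converges (at least) linearly to $\frac1{|x|}$, and consequently $x^2 f_k\to \frac{x^2}{|x|}=|x|$. If $x=0$, then $x^2f_k\to 0=|x|$. (ii) Let $x\ne 0$ and put $r_k=|x|\,f_k$ and $E_k=1-r_k$. Then there exist a constant $\alpha\le\frac58$ and an index $k_0$ such that $E_{k+1}\le \alpha E_k$ for all $k\ge k_0$. (iii) Let $x\neq 0$. Then $(f_k)$ converges to $\frac1{|x|}$ at a geometric rate with ratio at most $\frac12$; that is, there is an index $k_1$ such that $\bigl|f_{k+1}-\frac1{|x|}\bigr|\le \frac12\bigl|f_k-\frac1{|x|}\bigr|$ for all $k\ge k_1$.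
   Context: All quantities are real. The iteration is considered pointwise: $x$ is fixed, and the indices $k_0,k_1$ may depend on $x$. As functions of $x$, each $f_k$ is a polynomial. "Converges (at least) linearly to $L$" means that there exist $\rho\in(0,1)$ and an index $K$ with $|f_{k+1}-L|\le\rho|f_k-L|$ for all $k\ge K$. *)

theory Defs
  imports Complex_Main
begin

primrec fseq :: "real \<Rightarrow> nat \<Rightarrow> real" where
  "fseq x 0 = 1"
| "fseq x (Suc k) = 1 / 2 * fseq x k * (3 - x\<^sup>2 * (fseq x k)\<^sup>2)"

definition rseq :: "real \<Rightarrow> nat \<Rightarrow> real" where
  "rseq x k = \<bar>x\<bar> * fseq x k"

definition Eseq :: "real \<Rightarrow> nat \<Rightarrow> real" where
  "Eseq x k = 1 - rseq x k"

text \<open>Convergence at least linear in this sense implies \<open>a \<longlonglongrightarrow> L\<close>, since the ratio is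
  fixed and less than 1. Sequences that are eventually equal to \<open>L\<close> qualify.\<close>

definition converges_linearly :: "(nat \<Rightarrow> real) \<Rightarrow> real \<Rightarrow> bool" where
  "converges_linearly a L \<longleftrightarrow>
     (\<exists>\<rho> K. 0 < \<rho> \<and> \<rho> < 1 \<and> (\<forall>k\<ge>K. \<bar>a (Suc k) - L\<bar> \<le> \<rho> * \<bar>a k - L\<bar>))"

end

theory Submission
  imports Defs
begin

text \<open>
  The recursion is Newton's iteration for the inverse square root of \<open>x\<^sup>2\<close>, so its error contracts
  quadratically once it is small. The normalisation \<open>r = \<bar>x\<bar> f\<close> removes the parameter: one step
  becomes \<open>r \<mapsto> r (3 - r\<^sup>2) / 2\<close>, with fixed point \<open>1\<close>. Since \<open>1\<close> is a double root of
  \<open>1 - r (3 - r\<^sup>2) / 2\<close>, the error \<open>E = 1 - r\<close> is multiplied in one step by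
  \<open>E (3 - E) / 2\<close> (\<open>Eseq_Suc\<close>).

  The hypothesis \<open>\<bar>x\<bar> \<le> 1\<close> makes the start \<open>r = \<bar>x\<bar>\<close> lie at or below the fixed point, and the map
  sends the interval from \<open>\<bar>x\<bar>\<close> to \<open>1\<close> into itself (\<open>Eseq_bounds\<close>). On that interval the factor is largest
  at the left end, where it is less than \<open>1\<close> if \<open>x \<noteq> 0\<close>; hence the errors decay geometrically, with a
  ratio depending on \<open>x\<close> (\<open>Eseq_le_power\<close>). As soon as \<open>E \<le> 1/3\<close> the factor is at most \<open>1/2\<close>, and
  this single contraction (\<open>Eseq_eventually_halves\<close>) yields linear convergence and both explicit rates,
  because \<open>\<bar>f - 1/\<bar>x\<bar>\<bar> = E / \<bar>x\<bar>\<close>.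
\<close>

lemma Eseq_Suc: "Eseq x (Suc k) = Eseq x k * (Eseq x k * (3 - Eseq x k) / 2)"
proof -
  have step: "rseq x (Suc k) = rseq x k * (3 - (rseq x k)\<^sup>2) / 2"
    by (simp add: rseq_def power_mult_distrib)
  show ?thesis
    unfolding Eseq_def step by (simp add: field_simps power2_eq_square)
qed

text \<open>
  The upper bound persists because the contraction factor is at most \<open>1\<close> on the unit interval, so the
  errors never exceed their initial value \<open>1 - \<bar>x\<bar>\<close>.
\<close>

lemma Eseq_bounds:
  assumes "\<bar>x\<bar> \<le> 1"
  shows "0 \<le> Eseq x k \<and> Eseq x k \<le> 1 - \<bar>x\<bar>"
proof (induction k)
  case 0
  show ?case using assms by (simp add: Eseq_def rseq_def)
next
  case (Suc k)
  define e where "e = Eseq x k"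
  have e: "0 \<le> e" "e \<le> 1 - \<bar>x\<bar>" "e \<le> 1"
    using Suc by (auto simp: e_def)
  have "0 \<le> (1 - e) * (2 - e)"
    using e by (intro mult_nonneg_nonneg) auto
  then have "e * (3 - e) / 2 \<le> 1"
    by (simp add: algebra_simps)
  then have "e * (e * (3 - e) / 2) \<le> e"
    using e mult_left_le by blast
  moreover have "0 \<le> e * (e * (3 - e) / 2)"
    using e by simp
  ultimately show ?case
    unfolding Eseq_Suc e_def [symmetric] using e by linarith
qed

text \<open>
  The ratio is the contraction factor \<open>E (3 - E) / 2\<close> evaluated at the largest error \<open>E = 1 - \<bar>x\<bar>\<close>; the
  factor increases in \<open>E\<close> on the unit interval.
\<close>

lemma Eseq_le_power:
  assumes "\<bar>x\<bar> \<le> 1"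
  shows "Eseq x k \<le> ((1 - \<bar>x\<bar>) * (2 + \<bar>x\<bar>) / 2) ^ k"
proof (induction k)
  case 0
  show ?case by (simp add: Eseq_def rseq_def)
next
  case (Suc k)
  define e where "e = Eseq x k"
  define q where "q = (1 - \<bar>x\<bar>) * (2 + \<bar>x\<bar>) / 2"
  have e: "0 \<le> e" "e \<le> 1 - \<bar>x\<bar>"
    using Eseq_bounds [OF assms] by (auto simp: e_def)
  have "0 \<le> (1 - \<bar>x\<bar> - e) * (2 + \<bar>x\<bar> - e)"
    using e by (intro mult_nonneg_nonneg) auto
  also have "\<dots> = 2 * q - e * (3 - e)"
    by (simp add: q_def ring_distribs)
  finally have "e * (3 - e) / 2 \<le> q" by simp
  moreover have "0 \<le> q" using assms by (simp add: q_def)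
  moreover have "e \<le> q ^ k" using Suc by (simp add: e_def q_def)
  ultimately have "e * (e * (3 - e) / 2) \<le> q ^ k * q"
    using e by (intro mult_mono) auto
  then show ?case
    unfolding Eseq_Suc e_def [symmetric] q_def [symmetric] by (simp add: mult.commute)
qed

lemma Eseq_tendsto_0:
  assumes "\<bar>x\<bar> \<le> 1" "x \<noteq> 0"
  shows "Eseq x \<longlonglongrightarrow> 0"
proof -
  define q where "q = (1 - \<bar>x\<bar>) * (2 + \<bar>x\<bar>) / 2"
  have "2 * q = 2 - \<bar>x\<bar> * (1 + \<bar>x\<bar>)"
    by (simp add: q_def ring_distribs)
  moreover have "0 < \<bar>x\<bar> * (1 + \<bar>x\<bar>)"
    using assms by (intro mult_pos_pos) auto
  ultimately have "q < 1" by simp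
  moreover have "0 \<le> q" using assms by (simp add: q_def)
  ultimately have "(\<lambda>k. q ^ k) \<longlonglongrightarrow> 0"
    by (intro LIMSEQ_realpow_zero)
  then show ?thesis
    by (rule tendsto_sandwich [rotated 2, OF tendsto_const])
       (use Eseq_bounds [OF assms(1)] Eseq_le_power [OF assms(1)] in \<open>auto simp: q_def\<close>)
qed

lemma Eseq_eventually_halves:
  assumes "\<bar>x\<bar> \<le> 1" "x \<noteq> 0"
  obtains K where "\<And>k. k \<ge> K \<Longrightarrow> Eseq x (Suc k) \<le> 1 / 2 * Eseq x k"
proof -
  \<comment> \<open>Below \<open>1/3\<close> the factor \<open>E (3 - E) / 2 \<le> 3 E / 2\<close> is at most \<open>1/2\<close>.\<close>
  have "\<forall>\<^sub>F k in sequentially. Eseq x k < 1 / 3"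
    using Eseq_tendsto_0 [OF assms] by (rule order_tendstoD) simp
  then obtain K where K: "\<And>k. k \<ge> K \<Longrightarrow> Eseq x k < 1 / 3"
    by (auto simp: eventually_sequentially)
  show thesis
  proof (rule that)
    fix k assume "k \<ge> K"
    define e where "e = Eseq x k"
    have e: "0 \<le> e" "e < 1 / 3"
      using Eseq_bounds [OF assms(1)] K [OF \<open>k \<ge> K\<close>] by (auto simp: e_def)
    have "e * (3 - e) \<le> 1 / 3 * 3"
      using e by (intro mult_mono) auto
    then have "e * (e * (3 - e) / 2) \<le> e * (1 / 2)"
      using e by (intro mult_left_mono) auto
    then show "Eseq x (Suc k) \<le> 1 / 2 * Eseq x k"
      unfolding Eseq_Suc e_def [symmetric] by simp
  qed
qed

lemma abs_fseq_error:
  assumes "\<bar>x\<bar> \<le> 1" "x \<noteq> 0"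
  shows "\<bar>fseq x k - 1 / \<bar>x\<bar>\<bar> = Eseq x k / \<bar>x\<bar>"
proof -
  have "fseq x k - 1 / \<bar>x\<bar> = - (Eseq x k / \<bar>x\<bar>)"
    using assms(2) by (simp add: Eseq_def rseq_def field_simps)
  then show ?thesis
    using Eseq_bounds [OF assms(1), of k] by simp
qed

theorem theorem3p1:
  fixes x :: real
  assumes "x \<in> {-1..1}"
  shows "(x \<noteq> 0 \<longrightarrow>
            converges_linearly (fseq x) (1 / \<bar>x\<bar>) \<and>
            (\<lambda>k. x\<^sup>2 * fseq x k) \<longlonglongrightarrow> x\<^sup>2 / \<bar>x\<bar> \<and> x\<^sup>2 / \<bar>x\<bar> = \<bar>x\<bar>)
       \<and> (x = 0 \<longrightarrow> (\<lambda>k. x\<^sup>2 * fseq x k) \<longlonglongrightarrow> 0 \<and> 0 = \<bar>x\<bar>)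
       \<and> (x \<noteq> 0 \<longrightarrow>
            (\<exists>\<alpha> k0. \<alpha> \<le> 5 / 8 \<and> (\<forall>k\<ge>k0. Eseq x (Suc k) \<le> \<alpha> * Eseq x k)))
       \<and> (x \<noteq> 0 \<longrightarrow>
            (\<exists>k1. \<forall>k\<ge>k1.
               \<bar>fseq x (Suc k) - 1 / \<bar>x\<bar>\<bar> \<le> 1 / 2 * \<bar>fseq x k - 1 / \<bar>x\<bar>\<bar>))"
proof (cases "x = 0")
  case True
  then show ?thesis by simp
next
  case False
  have x: "\<bar>x\<bar> \<le> 1" using assms by auto
  obtain K where K: "\<And>k. k \<ge> K \<Longrightarrow> Eseq x (Suc k) \<le> 1 / 2 * Eseq x k"
    using Eseq_eventually_halves [OF x False] by blast
  have half: "\<bar>fseq x (Suc k) - 1 / \<bar>x\<bar>\<bar> \<le> 1 / 2 * \<bar>fseq x k - 1 / \<bar>x\<bar>\<bar>" if "k \<ge> K" for k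
    unfolding abs_fseq_error [OF x False]
    using divide_right_mono [OF K [OF that], of "\<bar>x\<bar>"] by simp
  have lin: "converges_linearly (fseq x) (1 / \<bar>x\<bar>)"
    unfolding converges_linearly_def
    by (intro exI [of _ "1 / 2"] exI [of _ K]) (simp add: half [simplified])
  have sq: "x\<^sup>2 / \<bar>x\<bar> = \<bar>x\<bar>"
    using False by (simp add: field_simps power2_eq_square)
  have "(\<lambda>k. \<bar>x\<bar> * (1 - Eseq x k)) \<longlonglongrightarrow> \<bar>x\<bar> * (1 - 0)"
    by (intro tendsto_intros Eseq_tendsto_0 x False)
  moreover have "\<bar>x\<bar> * (1 - Eseq x k) = x\<^sup>2 * fseq x k" for k
    by (simp add: Eseq_def rseq_def power2_eq_square mult.assoc [symmetric])
  ultimately have lim: "(\<lambda>k. x\<^sup>2 * fseq x k) \<longlonglongrightarrow> x\<^sup>2 / \<bar>x\<bar>"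
    using sq by simp
  have "\<exists>\<alpha> k0. \<alpha> \<le> 5 / 8 \<and> (\<forall>k\<ge>k0. Eseq x (Suc k) \<le> \<alpha> * Eseq x k)"
    by (intro exI [of _ "1 / 2"] exI [of _ K]) (simp add: K [simplified])
  moreover have "\<exists>k1. \<forall>k\<ge>k1. \<bar>fseq x (Suc k) - 1 / \<bar>x\<bar>\<bar> \<le> 1 / 2 * \<bar>fseq x k - 1 / \<bar>x\<bar>\<bar>"
    using half by blast
  ultimately show ?thesis
    using False lin lim sq by blast
qed

end
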